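(* For every natural number $n \geq 2$ and every natural number $m < 2^n$, there is a finite sequence $\vec{R} = \langle R_0,\ldots,R_{n-1}\rangle$ of subsets of $\omega$ such that for every partition $A_0,\ldots,A_{m-1}$ of $\omega$ that is arithmetical in $\vec{R}$, there is some $j<m$ and an infinite set $S \subseteq A_j$ such that $S$ computes no $\vec{R}$-cohesive set.
   Context: For a (finite or infinite) sequence $\vec{R} = \langle R_i \rangle$ of subsets of $\omega$, a set $S \subseteq \omega$ is called $\vec{R}$-cohesive if $S$ is infinite and for every index $i$, either $S \cap R_i$ is finite or $S \cap \overline{R_i}$ is finite. A set is arithmetical in $\vec{R}$ if it is definable by a first-order arithmetic formula with (a set coding) $\vec{R}$ as a parameter, equivalently if it is computable from some finite Turing jump of $\vec{R}$. "Computes" means Turing-computes. *)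

theory Defs
  imports Main "HOL-Library.Nat_Bijection" "HOL-Library.Disjoint_Sets"
begin

text \<open>
  Turing computability relative to an oracle \<open>X\<close>, via Kleene's schemes for the
  partial functions recursive in (the characteristic function of) \<open>X\<close>.
  A term of type \<open>recf\<close> is not tied to an arity: it denotes a partial function on argument lists.
  \<open>Prec\<close> and \<open>Mu\<close> recurse on, respectively minimise over, the head of the argument list.
\<close>

datatype recf =
    Zero
  | Succ
  | Proj nat
  | Oracle
  | Comp recf "recf list"
  | Prec recf recf
  | Mu recf

inductive oeval :: "nat set \<Rightarrow> recf \<Rightarrow> nat list \<Rightarrow> nat \<Rightarrow> bool" for X where
  oeval_Zero: "oeval X Zero xs 0"
| oeval_Succ: "oeval X Succ (x # xs) (Suc x)"
| oeval_Proj: "i < length xs \<Longrightarrow> oeval X (Proj i) xs (xs ! i)"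
| oeval_Oracle: "oeval X Oracle (x # xs) (of_bool (x \<in> X))"
| oeval_Comp: "list_all2 (\<lambda>g y. oeval X g xs y) gs ys \<Longrightarrow> oeval X f ys z \<Longrightarrow> oeval X (Comp f gs) xs z"
| oeval_Prec_0: "oeval X f xs z \<Longrightarrow> oeval X (Prec f g) (0 # xs) z"
| oeval_Prec_Suc: "oeval X (Prec f g) (k # xs) y \<Longrightarrow> oeval X g (k # y # xs) z
    \<Longrightarrow> oeval X (Prec f g) (Suc k # xs) z"
| oeval_Mu: "oeval X f (y # xs) 0 \<Longrightarrow> (\<forall>z<y. \<exists>v>0. oeval X f (z # xs) v) \<Longrightarrow> oeval X (Mu f) xs y"

definition computes :: "nat set \<Rightarrow> nat set \<Rightarrow> bool" where
  "computes X C \<longleftrightarrow> (\<exists>c. \<forall>x. oeval X c [x] (of_bool (x \<in> C)))"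

text \<open>First-order arithmetic with one additional unary predicate for a set parameter \<open>X\<close>.\<close>

datatype aterm =
    TVar nat
  | TZero
  | TSuc aterm
  | TPlus aterm aterm
  | TTimes aterm aterm

datatype aform =
    FEq aterm aterm
  | FLess aterm aterm
  | FMem aterm
  | FNot aform
  | FAnd aform aform
  | FEx nat aform

fun tval :: "(nat \<Rightarrow> nat) \<Rightarrow> aterm \<Rightarrow> nat" where
  "tval v (TVar i) = v i"
| "tval v TZero = 0"
| "tval v (TSuc s) = Suc (tval v s)"
| "tval v (TPlus s t) = tval v s + tval v t"
| "tval v (TTimes s t) = tval v s * tval v t"

fun sat :: "nat set \<Rightarrow> (nat \<Rightarrow> nat) \<Rightarrow> aform \<Rightarrow> bool" where
  "sat X v (FEq s t) \<longleftrightarrow> tval v s = tval v t"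
| "sat X v (FLess s t) \<longleftrightarrow> tval v s < tval v t"
| "sat X v (FMem s) \<longleftrightarrow> tval v s \<in> X"
| "sat X v (FNot p) \<longleftrightarrow> \<not> sat X v p"
| "sat X v (FAnd p q) \<longleftrightarrow> sat X v p \<and> sat X v q"
| "sat X v (FEx i p) \<longleftrightarrow> (\<exists>a. sat X (v(i := a)) p)"

fun tvars :: "aterm \<Rightarrow> nat set" where
  "tvars (TVar i) = {i}"
| "tvars TZero = {}"
| "tvars (TSuc s) = tvars s"
| "tvars (TPlus s t) = tvars s \<union> tvars t"
| "tvars (TTimes s t) = tvars s \<union> tvars t"

fun fvars :: "aform \<Rightarrow> nat set" where
  "fvars (FEq s t) = tvars s \<union> tvars t"
| "fvars (FLess s t) = tvars s \<union> tvars t"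
| "fvars (FMem s) = tvars s"
| "fvars (FNot p) = fvars p"
| "fvars (FAnd p q) = fvars p \<union> fvars q"
| "fvars (FEx i p) = fvars p - {i}"

text \<open>The only free variable is number 0, so the value of the valuation elsewhere is irrelevant.\<close>

definition arithmetical_in :: "nat set \<Rightarrow> nat set \<Rightarrow> bool" where
  "arithmetical_in X A \<longleftrightarrow> (\<exists>p. fvars p \<subseteq> {0} \<and> A = {a. sat X (\<lambda>_. a) p})"

text \<open>
  A sequence of sets is a function restricted to an index set \<open>I\<close>:
  \<open>{..<n}\<close> for a sequence of length \<open>n\<close>, \<open>UNIV\<close> for an infinite one.
\<close>

definition seq_code :: "nat set \<Rightarrow> (nat \<Rightarrow> nat set) \<Rightarrow> nat set" where
  "seq_code I R = {prod_encode (i, x) | i x. i \<in> I \<and> x \<in> R i}"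

definition cohesive :: "nat set \<Rightarrow> (nat \<Rightarrow> nat set) \<Rightarrow> nat set \<Rightarrow> bool" where
  "cohesive I R S \<longleftrightarrow> infinite S \<and> (\<forall>i\<in>I. finite (S \<inter> R i) \<or> finite (S \<inter> - R i))"

text \<open>Partitions are ordered and may have empty parts, as for colourings of \<open>\<omega>\<close> with \<open>m\<close> colours.\<close>

definition is_partition :: "nat \<Rightarrow> (nat \<Rightarrow> nat set) \<Rightarrow> bool" where
  "is_partition m A \<longleftrightarrow> (\<Union>j<m. A j) = UNIV \<and> disjoint_family_on A {..<m}"

end

theory Submission
  imports Defs "HOL-Library.Countable" "HOL-Library.Infinite_Set"
begin

text \<open>
  A set cohesive for \<open>n\<close> sets is eventually monochromatic for the colouring \<open>B\<close> of the numbers by the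
  \<open>2 ^ n\<close> atoms of the Boolean algebra generated by these sets. We build \<open>B\<close> by diagonalisation
  against a countable family of functions \<open>n \<mapsto> U\<^sub>n\<close> with \<open>U\<^sub>n \<subseteq> {n<..}\<close> finite: every colour
  class contains some \<open>U\<^sub>n\<close>. Given \<open>A\<^sub>0, \<dots>, A\<^bsub>m-1\<^esub>\<close>, Mathias forcing with finite stems \<open>F\<^sub>j \<subseteq> A\<^sub>j\<close>
  and a common reservoir \<open>X\<close> from a countable class produces sets \<open>S\<^sub>j \<subseteq> A\<^sub>j\<close>. If each \<open>S\<^sub>j\<close>
  computed an infinite, eventually monochromatic set, then, as there are more than \<open>m\<close> colours, some
  colour \<open>i\<close> would be eventually omitted by all of these sets. So it suffices that, for every colour
  \<open>i\<close> and all codes \<open>c\<^sub>j\<close>, some \<open>S\<^sub>j\<close> enumerates via \<open>c\<^sub>j\<close> either a finite set or some large number of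
  colour \<open>i\<close>. To force this, ask for each \<open>n\<close> whether every partition of \<open>X\<close> has a part \<open>j\<close> with a
  finite subset that, added to \<open>F\<^sub>j\<close>, enumerates a number above \<open>n\<close>. If so, by compactness the numbers
  can be taken from one finite set \<open>U\<^sub>n\<close>, some \<open>U\<^sub>n\<close> has colour \<open>i\<close>, and the given partition
  supplies the extension. If not, an infinite part of a counterexample partition is the new reservoir.
\<close>

section \<open>Oracle computations\<close>

instance recf :: countable
  by countable_datatype

inductive_cases oeval_ZeroE: "oeval X Zero xs z"
inductive_cases oeval_SuccE: "oeval X Succ xs z"
inductive_cases oeval_ProjE: "oeval X (Proj i) xs z"
inductive_cases oeval_OracleE: "oeval X Oracle xs z"
inductive_cases oeval_CompE: "oeval X (Comp f gs) xs z"
inductive_cases oeval_Prec_0E: "oeval X (Prec f g) (0 # xs) z"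
inductive_cases oeval_Prec_SucE: "oeval X (Prec f g) (Suc k # xs) z"
inductive_cases oeval_MuE: "oeval X (Mu f) xs z"

lemma oeval_deterministic:
  assumes "oeval X f xs y" and "oeval X f xs z"
  shows "y = z"
  using assms
proof (induction arbitrary: z)
  case (oeval_Comp xs gs ys f y)
  from oeval_Comp.prems obtain ys' where
    ys': "list_all2 (\<lambda>g y. oeval X g xs y) gs ys'" and f: "oeval X f ys' z"
    by (rule oeval_CompE)
  have "ys = ys'"
    using oeval_Comp.IH(1) ys' by (auto simp: list_all2_conv_all_nth intro!: nth_equalityI)
  then show ?case
    using oeval_Comp.IH(2) f by simp
next
  case (oeval_Mu f y xs)
  from oeval_Mu.prems have z: "oeval X f (z # xs) 0" "\<forall>w<z. \<exists>v>0. oeval X f (w # xs) v"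
    by (auto elim: oeval_MuE)
  show ?case
  proof (rule linorder_cases[of y z])
    assume "y < z"
    then obtain v where "v > 0" "oeval X f (y # xs) v"
      using z(2) by blast
    then show ?thesis
      using oeval_Mu.IH(1) by fastforce
  next
    assume "z < y"
    then obtain v where "v > 0" "\<forall>w. oeval X f (z # xs) w \<longrightarrow> v = w"
      using oeval_Mu.IH(2) by blast
    then show ?thesis
      using z(1) by fastforce
  qed simp
next
  case (oeval_Prec_Suc f g k xs y z')
  then show ?case
    by (metis oeval_Prec_SucE)
next
  case (oeval_Prec_0 f xs y g)
  then show ?case
    by (metis oeval_Prec_0E)
qed (erule oeval_ZeroE oeval_SuccE oeval_ProjE oeval_OracleE; simp)+

lemma agree_below_mono:
  fixes X Y :: "nat set"
  assumes "Y \<inter> {..<u} = X \<inter> {..<u}" and "v \<le> u"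
  shows "Y \<inter> {..<v} = X \<inter> {..<v}"
proof -
  have "Z \<inter> {..<v} = (Z \<inter> {..<u}) \<inter> {..<v}" for Z :: "nat set"
    using assms(2) by auto
  then show ?thesis
    using assms(1) by metis
qed

text \<open>Serves the \<open>Comp\<close> and \<open>Mu\<close> cases of the use principle, which
  combine finitely many subcomputations: the sum of their uses dominates each.\<close>

lemma common_use:
  fixes X :: "nat set" and n :: nat
  assumes "\<forall>i<n. \<exists>u. \<forall>Y. Y \<inter> {..<u} = X \<inter> {..<u} \<longrightarrow> Q i Y"
  shows "\<exists>u. \<forall>i<n. \<forall>Y. Y \<inter> {..<u} = X \<inter> {..<u} \<longrightarrow> Q i Y"
proof -
  from assms obtain u where u: "\<And>i Y. i < n \<Longrightarrow> Y \<inter> {..<u i} = X \<inter> {..<u i} \<Longrightarrow> Q i Y"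
    by metis
  have "Q i Y" if "i < n" "Y \<inter> {..<\<Sum>i<n. u i} = X \<inter> {..<\<Sum>i<n. u i}" for i Y
  proof -
    have "u i \<le> (\<Sum>i<n. u i)"
      using that(1) by (intro member_le_sum) auto
    then show ?thesis
      using u that agree_below_mono by metis
  qed
  then show ?thesis
    by blast
qed

text \<open>The use principle: a halting computation queries its oracle only finitely often, so an
  initial segment of the oracle fixes its result.\<close>

lemma oeval_use:
  assumes "oeval X f xs y"
  shows "\<exists>u. \<forall>Y. Y \<inter> {..<u} = X \<inter> {..<u} \<longrightarrow> oeval Y f xs y"
  using assms
proof induction
  case (oeval_Oracle x xs)
  have "oeval Y Oracle (x # xs) (of_bool (x \<in> X))" if "Y \<inter> {..<Suc x} = X \<inter> {..<Suc x}" for Y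
  proof -
    have "x \<in> Y \<longleftrightarrow> x \<in> X"
      using that by blast
    then show ?thesis
      using oeval.oeval_Oracle[of Y x xs] by simp
  qed
  then show ?case
    by blast
next
  case (oeval_Comp xs gs ys f z)
  have len: "length gs = length ys"
    using oeval_Comp.IH(1) by (auto dest: list_all2_lengthD)
  have "\<forall>i<length gs. \<exists>u. \<forall>Y. Y \<inter> {..<u} = X \<inter> {..<u} \<longrightarrow> oeval Y (gs ! i) xs (ys ! i)"
    using oeval_Comp.IH(1) by (auto simp: list_all2_conv_all_nth)
  from common_use[OF this] obtain u where
    u: "\<forall>i<length gs. \<forall>Y. Y \<inter> {..<u} = X \<inter> {..<u} \<longrightarrow> oeval Y (gs ! i) xs (ys ! i)" ..
  from oeval_Comp.IH(2) obtain v where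
    v: "\<forall>Y. Y \<inter> {..<v} = X \<inter> {..<v} \<longrightarrow> oeval Y f ys z" ..
  have "oeval Y (Comp f gs) xs z" if "Y \<inter> {..<max u v} = X \<inter> {..<max u v}" for Y
  proof (rule oeval.oeval_Comp)
    show "list_all2 (\<lambda>g y. oeval Y g xs y) gs ys"
      using u len agree_below_mono[OF that, of u] by (simp add: list_all2_conv_all_nth)
    show "oeval Y f ys z"
      using v agree_below_mono[OF that, of v] by simp
  qed
  then show ?case
    by blast
next
  case (oeval_Prec_Suc f g k xs y z)
  then obtain u v where
    u: "\<forall>Y. Y \<inter> {..<u} = X \<inter> {..<u} \<longrightarrow> oeval Y (Prec f g) (k # xs) y" and
    v: "\<forall>Y. Y \<inter> {..<v} = X \<inter> {..<v} \<longrightarrow> oeval Y g (k # y # xs) z"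
    by blast
  have "oeval Y (Prec f g) (Suc k # xs) z" if "Y \<inter> {..<max u v} = X \<inter> {..<max u v}" for Y
    using u v agree_below_mono[OF that, of u] agree_below_mono[OF that, of v]
    by (auto intro: oeval.oeval_Prec_Suc)
  then show ?case
    by blast
next
  case (oeval_Mu f y xs)
  from oeval_Mu.IH(1) obtain u where
    u: "\<forall>Y. Y \<inter> {..<u} = X \<inter> {..<u} \<longrightarrow> oeval Y f (y # xs) 0" ..
  have "\<forall>z<y. \<exists>u. \<forall>Y. Y \<inter> {..<u} = X \<inter> {..<u} \<longrightarrow> (\<exists>w>0. oeval Y f (z # xs) w)"
    using oeval_Mu.IH(2) by meson
  from common_use[OF this] obtain v where
    v: "\<forall>z<y. \<forall>Y. Y \<inter> {..<v} = X \<inter> {..<v} \<longrightarrow> (\<exists>w>0. oeval Y f (z # xs) w)" ..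
  have "oeval Y (Mu f) xs y" if "Y \<inter> {..<max u v} = X \<inter> {..<max u v}" for Y
  proof (rule oeval.oeval_Mu)
    show "oeval Y f (y # xs) 0"
      using u agree_below_mono[OF that, of u] by simp
    show "\<forall>z<y. \<exists>w>0. oeval Y f (z # xs) w"
      using v agree_below_mono[OF that, of v] by simp
  qed
  then show ?case
    by blast
next
  case (oeval_Prec_0 f xs z g)
  then show ?case
    using oeval.oeval_Prec_0 by metis
qed (simp_all add: oeval.oeval_Zero oeval.oeval_Succ oeval.oeval_Proj)

section \<open>Compactness and diagonalisation\<close>

text \<open>Koenig's lemma. If every bound failed, the prefixes that extend to failures for all
  bounds would contain an infinite path \<open>d\<close>. Some \<open>H b d\<close> holds, and
  locality transfers it to a failure sharing the first \<open>b\<close> values.\<close>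

lemma finite_branching_compactness:
  fixes H :: "nat \<Rightarrow> (nat \<Rightarrow> 'a) \<Rightarrow> bool"
  assumes J: "finite J"
    and mono: "\<And>b b' d. b \<le> b' \<Longrightarrow> H b d \<Longrightarrow> H b' d"
    and local: "\<And>b d d'. (\<And>a. a < b \<Longrightarrow> d a = d' a) \<Longrightarrow> H b d \<Longrightarrow> H b d'"
    and ex: "\<And>d. range d \<subseteq> J \<Longrightarrow> \<exists>b. H b d"
  shows "\<exists>b. \<forall>d. range d \<subseteq> J \<longrightarrow> H b d"
proof (rule ccontr)
  assume neg: "\<not> ?thesis"
  define bad where "bad xs \<longleftrightarrow> (\<forall>b. \<exists>d. range d \<subseteq> J \<and> (\<forall>a<length xs. d a = xs ! a) \<and> \<not> H b d)" for xs
  have bad_Nil: "bad []"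
    using neg by (auto simp: bad_def)
  have bad_snoc: "\<exists>v\<in>J. bad (xs @ [v])" if xs: "bad xs" for xs
  proof (rule ccontr)
    assume "\<not> ?thesis"
    then have "\<forall>v\<in>J. \<exists>b. \<forall>d. \<not> (range d \<subseteq> J \<and> (\<forall>a<Suc (length xs). d a = (xs @ [v]) ! a) \<and> \<not> H b d)"
      unfolding bad_def length_append_singleton by (simp only: bex_simps not_all not_ex not_not)
    then obtain \<beta> where \<beta>: "\<And>v d. v \<in> J \<Longrightarrow> range d \<subseteq> J \<Longrightarrow>
        \<forall>a<Suc (length xs). d a = (xs @ [v]) ! a \<Longrightarrow> H (\<beta> v) d"
      by metis
    obtain d where d: "range d \<subseteq> J" "\<forall>a<length xs. d a = xs ! a" "\<not> H (\<Sum>v\<in>J. \<beta> v) d"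
      using xs unfolding bad_def by blast
    have v: "d (length xs) \<in> J"
      using d(1) by auto
    have "H (\<beta> (d (length xs))) d"
      using \<beta>[OF v d(1)] d(2) by (auto simp: nth_append less_Suc_eq)
    moreover have "\<beta> (d (length xs)) \<le> (\<Sum>v\<in>J. \<beta> v)"
      using J v by (intro member_le_sum) auto
    ultimately show False
      using mono d(3) by blast
  qed
  have "\<exists>f. \<forall>n. (bad (f n) \<and> length (f n) = n) \<and> (\<exists>v\<in>J. f (Suc n) = f n @ [v])"
  proof (rule dependent_nat_choice)
    show "\<exists>xs. bad xs \<and> length xs = 0"
      using bad_Nil by simp
    show "\<exists>ys. (bad ys \<and> length ys = Suc n) \<and> (\<exists>v\<in>J. ys = xs @ [v])"
      if "bad xs \<and> length xs = n" for xs n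
    proof -
      obtain v where "v \<in> J" "bad (xs @ [v])"
        using bad_snoc \<open>bad xs \<and> length xs = n\<close> by blast
      then show ?thesis
        using that by (intro exI[of _ "xs @ [v]"]) simp
    qed
  qed
  then obtain f where f: "\<And>n. bad (f n)" "\<And>n. length (f n) = n" "\<And>n. \<exists>v\<in>J. f (Suc n) = f n @ [v]"
    by blast
  define d where "d n = f (Suc n) ! n" for n
  have "d n \<in> J" for n
    using f(2)[of n] f(3)[of n] by (auto simp: d_def nth_append)
  then obtain b where b: "H b d"
    using ex[of d] by blast
  have prefix: "a < n \<Longrightarrow> f n ! a = d a" for a n
  proof (induction n)
    case (Suc n)
    then show ?case
      using f(2)[of n] f(3)[of n] by (cases "a = n") (auto simp: d_def nth_append)
  qed simp
  obtain d' where d': "range d' \<subseteq> J" "\<forall>a<length (f b). d' a = f b ! a" "\<not> H b d'"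
    using f(1)[of b] unfolding bad_def by blast
  have "H b d'"
    using local[OF _ b, of d'] d'(2) prefix f(2) by auto
  then show False
    using d'(3) by blast
qed

text \<open>Stages run through all triples \<open>(q, i, N)\<close>. Each stage colours a set lying
  above the sets of all earlier stages, so no two stages conflict.\<close>

lemma diagonal_colouring:
  fixes g :: "'q::countable \<Rightarrow> nat \<Rightarrow> nat set"
  assumes fin: "\<And>q n. finite (g q n)" and above: "\<And>q n. g q n \<subseteq> {n<..}" and k: "k > 0"
  shows "\<exists>B :: nat \<Rightarrow> nat. (\<forall>x. B x < k) \<and> (\<forall>q. \<forall>i<k. \<forall>N. \<exists>n\<ge>N. \<forall>x\<in>g q n. B x = i)"
proof -
  define Q where "Q s = fst (from_nat s :: 'q \<times> nat \<times> nat)" for s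
  define I where "I s = fst (snd (from_nat s :: 'q \<times> nat \<times> nat))" for s
  define N where "N s = snd (snd (from_nat s :: 'q \<times> nat \<times> nat))" for s
  define b where "b = rec_nat 0 (\<lambda>s r. Max (insert (max r (N s)) (g (Q s) (max r (N s)))))"
  define V where "V s = g (Q s) (max (b s) (N s))" for s
  have b_Suc: "b (Suc s) = Max (insert (max (b s) (N s)) (V s))" for s
    by (simp add: b_def V_def)
  have finV: "finite (V s)" for s
    using fin by (simp add: V_def)
  have "b s \<le> b (Suc s)" for s
    unfolding b_Suc using finV by (auto simp: Max_ge_iff)
  then have b_mono: "s \<le> t \<Longrightarrow> b s \<le> b t" for s t
    by (rule lift_Suc_mono_le)
  have V: "b s < x \<and> x \<le> b (Suc s)" if "x \<in> V s" for s x
  proof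
    show "b s < x"
      using that above[of "Q s" "max (b s) (N s)"] by (auto simp: V_def)
    show "x \<le> b (Suc s)"
      unfolding b_Suc using finV that by (auto intro: Max_ge)
  qed
  have V_unique: "s = t" if "x \<in> V s" "x \<in> V t" for s t x
  proof (rule ccontr)
    assume "s \<noteq> t"
    then have "Suc s \<le> t \<or> Suc t \<le> s"
      by auto
    then show False
      using b_mono V[OF that(1)] V[OF that(2)] by (meson leD le_trans)
  qed
  \<comment> \<open>Stages with \<open>I s \<ge> k\<close> name no colour and are skipped; the
    default 0 is a colour because \<open>k > 0\<close>.\<close>
  define B where "B x = (if \<exists>s. x \<in> V s \<and> I s < k then I (THE s. x \<in> V s) else 0)" for x
  have B: "B x = I s" if "x \<in> V s" "I s < k" for x s
  proof -
    have "(THE s. x \<in> V s) = s"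
      using that V_unique by blast
    then show ?thesis
      using that by (auto simp: B_def)
  qed
  have "B x < k" for x
  proof (cases "\<exists>s. x \<in> V s \<and> I s < k")
    case True
    then show ?thesis
      using B by metis
  next
    case False
    then show ?thesis
      using k by (auto simp: B_def)
  qed
  moreover have "\<exists>n\<ge>M. \<forall>x\<in>g q n. B x = i" if "i < k" for q i M
  proof -
    define s where "s = to_nat (q, i, M)"
    have s: "Q s = q" "I s = i" "N s = M"
      by (simp_all add: s_def Q_def I_def N_def)
    then have "\<forall>x\<in>g q (max (b s) M). B x = i"
      using B[of _ s] that by (auto simp: V_def)
    then show ?thesis
      by (intro exI[of _ "max (b s) M"]) auto
  qed
  ultimately show ?thesis
    by blast
qed

section \<open>Reservoirs\<close>

text \<open>Read \<open>P c S x\<close> as: code \<open>c\<close> with oracle \<open>S\<close>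
  enumerates \<open>x\<close>. Countably many codes and finite use are all that the forcing takes
  from computability.\<close>

locale finite_use =
  fixes P :: "'c::countable \<Rightarrow> nat set \<Rightarrow> nat \<Rightarrow> bool"
  assumes use: "P c S x \<Longrightarrow> \<exists>u. \<forall>T. T \<inter> {..<u} = S \<inter> {..<u} \<longrightarrow> P c T x"
begin

text \<open>Here \<open>d\<close> stands for a partition of \<open>X\<close> into parts indexed by
  \<open>J\<close>. Lists encode the parameters so that they range over a countable type.\<close>

definition hit :: "nat set \<Rightarrow> nat list \<Rightarrow> nat list list \<Rightarrow> 'c list \<Rightarrow> nat set \<Rightarrow> (nat \<Rightarrow> nat) \<Rightarrow> bool" where
  "hit X J F c U d \<longleftrightarrow> (\<exists>j\<in>set J. \<exists>E x. finite E \<and> E \<subseteq> X \<and> (\<forall>a\<in>E. d a = j) \<and> x \<in> U \<and>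
    P (c ! j) (set (F ! j) \<union> E) x)"

lemma hit_mono: "hit X J F c U d \<Longrightarrow> X \<subseteq> X' \<Longrightarrow> U \<subseteq> U' \<Longrightarrow> hit X' J F c U' d"
  unfolding hit_def by blast

text \<open>A hit consists of a finite set and one number, hence shows below some bound; compactness
  makes the bound uniform in \<open>d\<close>.\<close>

lemma hit_compact:
  assumes "\<And>d. range d \<subseteq> set J \<Longrightarrow> hit X J F c {n<..} d"
  shows "\<exists>U. finite U \<and> U \<subseteq> {n<..} \<and> (\<forall>d. range d \<subseteq> set J \<longrightarrow> hit X J F c U d)"
proof -
  have "\<exists>b. \<forall>d. range d \<subseteq> set J \<longrightarrow> hit (X \<inter> {..<b}) J F c {n<..<b} d"
  proof (rule finite_branching_compactness)
    show "hit (X \<inter> {..<b'}) J F c {n<..<b'} d"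
      if "b \<le> b'" "hit (X \<inter> {..<b}) J F c {n<..<b} d" for b b' d
      using that by (elim hit_mono) auto
    show "hit (X \<inter> {..<b}) J F c {n<..<b} d'"
      if eq: "\<And>a. a < b \<Longrightarrow> d a = d' a" and h: "hit (X \<inter> {..<b}) J F c {n<..<b} d" for b d d'
    proof -
      from h obtain j E x where *: "j \<in> set J" "finite E" "E \<subseteq> X \<inter> {..<b}" "\<forall>a\<in>E. d a = j"
        "x \<in> {n<..<b}" "P (c ! j) (set (F ! j) \<union> E) x"
        unfolding hit_def by blast
      moreover have "\<forall>a\<in>E. d' a = j"
        using *(3,4) eq by fastforce
      ultimately show ?thesis
        unfolding hit_def by blast
    qed
    show "\<exists>b. hit (X \<inter> {..<b}) J F c {n<..<b} d" if "range d \<subseteq> set J" for d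
    proof -
      from assms[OF that] obtain j E x where *: "j \<in> set J" "finite E" "E \<subseteq> X" "\<forall>a\<in>E. d a = j"
        "x \<in> {n<..}" "P (c ! j) (set (F ! j) \<union> E) x"
        unfolding hit_def by blast
      define b where "b = Suc (Max (insert x E))"
      have "a < b" if "a \<in> insert x E" for a
        using that *(2) unfolding b_def by (intro le_imp_less_Suc Max_ge) auto
      then have "E \<subseteq> X \<inter> {..<b}" "x \<in> {n<..<b}"
        using *(3,5) by auto
      then show ?thesis
        unfolding hit_def using * by blast
    qed
  qed simp
  then obtain b where b: "\<And>d. range d \<subseteq> set J \<Longrightarrow> hit (X \<inter> {..<b}) J F c {n<..<b} d"
    by blast
  have "hit X J F c {n<..<b} d" if "range d \<subseteq> set J" for d
    using b[OF that] by (rule hit_mono) auto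
  then show ?thesis
    by (intro exI[of _ "{n<..<b}"]) auto
qed

definition avoider :: "nat set \<Rightarrow> nat list \<Rightarrow> nat list list \<Rightarrow> 'c list \<Rightarrow> nat \<Rightarrow> nat \<Rightarrow> nat" where
  "avoider X J F c n = (SOME d. range d \<subseteq> set J \<and> \<not> hit X J F c {n<..} d)"

definition is_cover :: "nat set \<Rightarrow> nat list \<Rightarrow> nat list list \<Rightarrow> 'c list \<Rightarrow> nat \<Rightarrow> nat set \<Rightarrow> bool" where
  "is_cover X J F c n U \<longleftrightarrow>
    finite U \<and> U \<subseteq> {n<..} \<and> (\<forall>d. range d \<subseteq> set J \<longrightarrow> hit X J F c U d)"

text \<open>The default \<open>{}\<close> keeps finiteness and the lower bound valid for all
  parameters, as diagonalising against a total family requires.\<close>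

definition cover :: "nat set \<Rightarrow> nat list \<Rightarrow> nat list list \<Rightarrow> 'c list \<Rightarrow> nat \<Rightarrow> nat set" where
  "cover X J F c n = (if \<exists>U. is_cover X J F c n U then SOME U. is_cover X J F c n U else {})"

lemma cover_avoider_cases:
  obtains (avoid) "range (avoider X J F c n) \<subseteq> set J" "\<not> hit X J F c {n<..} (avoider X J F c n)"
    | (cover) "is_cover X J F c n (cover X J F c n)"
proof (cases "\<exists>d. range d \<subseteq> set J \<and> \<not> hit X J F c {n<..} d")
  case True
  then have "range (avoider X J F c n) \<subseteq> set J \<and> \<not> hit X J F c {n<..} (avoider X J F c n)"
    unfolding avoider_def by (rule someI_ex)
  then show ?thesis
    using avoid by blast
next
  case False
  then have ex: "\<exists>U. is_cover X J F c n U"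
    unfolding is_cover_def by (intro hit_compact) blast
  then have "is_cover X J F c n (cover X J F c n)"
    unfolding cover_def using someI_ex[OF ex] by simp
  then show ?thesis
    by (rule cover)
qed

lemma cover_bounds: "finite (cover X J F c n)" "cover X J F c n \<subseteq> {n<..}"
proof -
  have "is_cover X J F c n (cover X J F c n) \<or> cover X J F c n = {}"
    using someI_ex[of "is_cover X J F c n"] by (auto simp: cover_def)
  then show "finite (cover X J F c n)" "cover X J F c n \<subseteq> {n<..}"
    by (auto simp: is_cover_def)
qed

text \<open>
  The parameters have a countable type, so only countably many reservoirs arise and one colouring can
  diagonalise against all of them.
\<close>

definition shrink :: "nat + nat list \<times> nat list list \<times> 'c list \<times> nat \<times> nat \<Rightarrow> nat set \<Rightarrow> nat set" where
  "shrink p X = (case p of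
      Inl u \<Rightarrow> {a \<in> X. u < a}
    | Inr (J, F, c, n, j) \<Rightarrow> {a \<in> X. avoider X J F c n a = j})"

definition reservoirs :: "nat set set" where
  "reservoirs = range (\<lambda>ps. foldr shrink ps UNIV)"

lemma UNIV_reservoir: "UNIV \<in> reservoirs"
  unfolding reservoirs_def by (rule range_eqI[of _ _ "[]"]) simp

lemma shrink_reservoir: "X \<in> reservoirs \<Longrightarrow> shrink p X \<in> reservoirs"
  unfolding reservoirs_def by (metis (no_types, lifting) foldr_Cons comp_apply rangeE rangeI)

lemma reservoir_above: "X \<in> reservoirs \<Longrightarrow> {a \<in> X. u < a} \<in> reservoirs"
  using shrink_reservoir[of X "Inl u"] by (simp add: shrink_def)

lemma reservoir_avoider: "X \<in> reservoirs \<Longrightarrow> {a \<in> X. avoider X J F c n a = j} \<in> reservoirs"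
  using shrink_reservoir[of X "Inr (J, F, c, n, j)"] by (simp add: shrink_def)

definition diagonal :: "nat \<Rightarrow> (nat \<Rightarrow> nat) \<Rightarrow> bool" where
  "diagonal k B \<longleftrightarrow> (\<forall>X\<in>reservoirs. \<forall>J F c N. \<forall>i<k. \<exists>n\<ge>N. \<forall>x\<in>cover X J F c n. B x = i)"

lemma diagonal_exists:
  assumes "k > 0"
  shows "\<exists>B. (\<forall>x. B x < k) \<and> diagonal k B"
proof -
  \<comment> \<open>A reservoir enters through the finite list \<open>ps\<close> of shrinking steps
    that produces it, so the index type is countable.\<close>
  define g :: "(nat + nat list \<times> nat list list \<times> 'c list \<times> nat \<times> nat) list \<times>
      nat list \<times> nat list list \<times> 'c list \<Rightarrow> nat \<Rightarrow> nat set"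
    where "g = (\<lambda>(ps, J, F, c). cover (foldr shrink ps UNIV) J F c)"
  have "\<exists>B :: nat \<Rightarrow> nat. (\<forall>x. B x < k) \<and> (\<forall>q. \<forall>i<k. \<forall>N. \<exists>n\<ge>N. \<forall>x\<in>g q n. B x = i)"
    by (rule diagonal_colouring) (use assms cover_bounds in \<open>auto simp: g_def split: prod.splits\<close>)
  then obtain B where B: "\<And>x. B x < k" "\<And>q i N. i < k \<Longrightarrow> \<exists>n\<ge>N. \<forall>x\<in>g q n. B x = i"
    by blast
  have "diagonal k B"
    unfolding diagonal_def reservoirs_def using B(2)[of _ _ "(_, _, _, _)"] by (auto simp: g_def)
  then show ?thesis
    using B(1) by blast
qed

end

section \<open>Mathias forcing\<close>

text \<open>\<open>J\<close> indexes the parts that stay relevant: they cover \<open>X0\<close>, so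
  the partition induces a colouring by \<open>J\<close> on each reservoir, and
  \<open>persistent\<close> leaves every stem room to grow however the reservoir shrinks.\<close>

locale mathias = finite_use P for P :: "'c::countable \<Rightarrow> nat set \<Rightarrow> nat \<Rightarrow> bool" +
  fixes k m :: nat and B :: "nat \<Rightarrow> nat" and A :: "nat \<Rightarrow> nat set" and J :: "nat list" and X0 :: "nat set"
  assumes diag: "diagonal k B"
    and J_bound: "set J \<subseteq> {..<m}"
    and J_nonempty: "set J \<noteq> {}"
    and X0: "X0 \<in> reservoirs" "infinite X0" "X0 \<subseteq> (\<Union>j\<in>set J. A j)"
    and persistent: "\<And>X j. X \<in> reservoirs \<Longrightarrow> infinite X \<Longrightarrow> X \<subseteq> X0 \<Longrightarrow> j \<in> set J \<Longrightarrow> infinite (A j \<inter> X)"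
begin

fun cond :: "nat list list \<times> nat set \<Rightarrow> bool" where
  "cond (F, X) \<longleftrightarrow> length F = m \<and> X \<in> reservoirs \<and> infinite X \<and> X \<subseteq> X0 \<and> (\<forall>j\<in>set J. set (F ! j) \<subseteq> A j)"

text \<open>The sets that a condition still admits as the \<open>j\<close>-th generic set. Stem and
  reservoir may overlap, so a computation is protected by cutting the reservoir above its
  use.\<close>

fun between :: "nat \<Rightarrow> nat list list \<times> nat set \<Rightarrow> nat set \<Rightarrow> bool" where
  "between j (F, X) S \<longleftrightarrow> set (F ! j) \<subseteq> S \<and> S \<subseteq> set (F ! j) \<union> X"

fun extends :: "nat list list \<times> nat set \<Rightarrow> nat list list \<times> nat set \<Rightarrow> bool" where
  "extends (F', X') p \<longleftrightarrow> X' \<subseteq> snd p \<and> (\<forall>j\<in>set J. between j p (set (F' ! j)))"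

definition decides :: "nat \<Rightarrow> 'c list \<Rightarrow> nat \<Rightarrow> nat list list \<times> nat set \<Rightarrow> bool" where
  "decides i c N p \<longleftrightarrow> (\<exists>j\<in>set J.
    (\<exists>x\<ge>N. B x = i \<and> (\<forall>S. between j p S \<longrightarrow> P (c ! j) S x)) \<or>
    (\<exists>n. \<forall>S x. between j p S \<longrightarrow> P (c ! j) S x \<longrightarrow> x \<le> n))"

lemma extends_trans:
  assumes "extends p q" "extends q r"
  shows "extends p r"
proof -
  obtain F X G Y H Z where p: "p = (F, X)" "q = (G, Y)" "r = (H, Z)"
    by (metis surj_pair)
  have "between j (H, Z) (set (F ! j))" if "j \<in> set J" for j
  proof -
    have "between j (G, Y) (set (F ! j))" "between j (H, Z) (set (G ! j))" "Y \<subseteq> Z"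
      using assms that p by auto
    then show ?thesis
      by auto
  qed
  then show ?thesis
    using assms p by auto
qed

text \<open>Cutting \<open>S\<close> at the use of the computation leaves a finite set. So if no
  finite part of the reservoir yields \<open>x\<close>, no admissible set does.\<close>

lemma finite_use_between:
  assumes "P c S x" "between j (F, X) S"
  shows "\<exists>E. finite E \<and> E \<subseteq> X \<and> E \<subseteq> S \<and> P c (set (F ! j) \<union> E) x"
proof -
  obtain u where u: "\<And>T. T \<inter> {..<u} = S \<inter> {..<u} \<Longrightarrow> P c T x"
    using use[OF assms(1)] by blast
  define E where "E = (S - set (F ! j)) \<inter> {..<u}"
  have "P c (set (F ! j) \<union> E) x"
    by (rule u) (use assms(2) in \<open>auto simp: E_def\<close>)
  moreover have "finite E" "E \<subseteq> X" "E \<subseteq> S"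
    using assms(2) by (auto simp: E_def)
  ultimately show ?thesis
    by blast
qed

lemma extension_grow:
  assumes "cond (F, X)"
  shows "\<exists>F'. cond (F', X) \<and> extends (F', X) (F, X) \<and> (\<forall>j\<in>set J. \<exists>a\<in>set (F' ! j). N \<le> a)"
proof -
  have "\<exists>a. a \<in> A j \<inter> X \<and> N \<le> a" if "j \<in> set J" for j
    using persistent[of X j] assms that by (metis cond.simps infinite_nat_iff_unbounded_le)
  then obtain a where a: "\<And>j. j \<in> set J \<Longrightarrow> a j \<in> A j \<inter> X \<and> N \<le> a j"
    by metis
  define F' where "F' = map (\<lambda>j. if j \<in> set J then a j # F ! j else F ! j) [0..<m]"
  have "F' ! j = a j # F ! j" if "j \<in> set J" for j
    using that J_bound by (auto simp: F'_def)
  then show ?thesis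
    using a assms by (intro exI[of _ F']) (auto simp: F'_def)
qed

lemma extension_decide:
  assumes cond: "cond (F, X)" and i: "i < k"
  shows "\<exists>p. cond p \<and> extends p (F, X) \<and> decides i c N p"
proof -
  from cond have F: "length F = m" "\<And>j. j \<in> set J \<Longrightarrow> set (F ! j) \<subseteq> A j"
    and X: "X \<in> reservoirs" "infinite X" "X \<subseteq> X0"
    by auto
  \<comment> \<open>The same \<open>n\<close> serves both cases: its cover has colour
    \<open>i\<close> throughout, and \<open>n\<close> bounds the enumerated numbers if there is an
    avoider.\<close>
  obtain n where n: "N \<le> n" "\<forall>x\<in>cover X J F c n. B x = i"
    using diag X(1) i unfolding diagonal_def by blast
  show ?thesis
  proof (cases rule: cover_avoider_cases[of X J F c n])
    case avoid
    let ?d = "avoider X J F c n"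
    \<comment> \<open>Pigeonhole: one of the finitely many classes of the avoider is infinite and
      becomes the new reservoir.\<close>
    have "X = (\<Union>j\<in>set J. {a \<in> X. ?d a = j})"
      using avoid(1) by auto
    then obtain j where j: "j \<in> set J" "infinite {a \<in> X. ?d a = j}"
      using X(2) by (metis (no_types, lifting) List.finite_set finite_UN_I)
    let ?p = "(F, {a \<in> X. ?d a = j})"
    have "x \<le> n" if S: "between j ?p S" and x: "P (c ! j) S x" for S x
    proof (rule ccontr)
      assume "\<not> x \<le> n"
      moreover obtain E where "finite E" "E \<subseteq> {a \<in> X. ?d a = j}" "P (c ! j) (set (F ! j) \<union> E) x"
        using finite_use_between[OF x S] by blast
      ultimately have "hit X J F c {n<..} ?d"
        unfolding hit_def using j(1) by (intro bexI[of _ j] exI[of _ E] exI[of _ x]) auto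
      then show False
        using avoid(2) by blast
    qed
    then have "decides i c N ?p"
      unfolding decides_def using j(1) by blast
    moreover have "cond ?p" "extends ?p (F, X)"
      using F X j reservoir_avoider[OF X(1)] by auto
    ultimately show ?thesis
      by blast
  next
    case cover
    \<comment> \<open>Covers are tested against total colourings with values in \<open>J\<close>: on
      \<open>X\<close> the partition supplies the value, elsewhere any member of \<open>J\<close>
      will do.\<close>
    have "\<exists>j. j \<in> set J \<and> (a \<in> X \<longrightarrow> a \<in> A j)" for a
    proof (cases "a \<in> X")
      case True
      then show ?thesis
        using X(3) X0(3) by blast
    next
      case False
      then show ?thesis
        using J_nonempty by (metis ex_in_conv)
    qed
    then obtain d where d: "\<And>a. d a \<in> set J" "\<And>a. a \<in> X \<Longrightarrow> a \<in> A (d a)"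
      by metis
    then have "hit X J F c (cover X J F c n) d"
      using cover unfolding is_cover_def by blast
    then obtain j E x where j: "j \<in> set J" and E: "finite E" "E \<subseteq> X" "\<forall>a\<in>E. d a = j"
      and x: "x \<in> cover X J F c n" "P (c ! j) (set (F ! j) \<union> E) x"
      unfolding hit_def by blast
    obtain u where u: "\<And>T. T \<inter> {..<u} = (set (F ! j) \<union> E) \<inter> {..<u} \<Longrightarrow> P (c ! j) T x"
      using use[OF x(2)] by blast
    obtain es where es: "set es = E"
      using finite_list[OF E(1)] by blast
    define F' where "F' = F[j := es @ F ! j]"
    have jm: "j < m"
      using j J_bound by auto
    have F'_j: "set (F' ! j) = set (F ! j) \<union> E"
      using jm F(1) es by (auto simp: F'_def)
    have F'_other: "l \<noteq> j \<Longrightarrow> F' ! l = F ! l" for l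
      by (simp add: F'_def)
    let ?p = "(F', {a \<in> X. u < a})"
    have "P (c ! j) S x" if "between j ?p S" for S
      by (rule u) (use that F'_j in auto)
    moreover have "B x = i" "N \<le> x"
      using n x(1) cover_bounds(2) by fastforce+
    ultimately have dec: "decides i c N ?p"
      unfolding decides_def using j by blast
    have "infinite {a \<in> X. u < a}"
    proof -
      have "X \<subseteq> {a \<in> X. u < a} \<union> {..u}"
        by auto
      then show ?thesis
        using X(2) by (meson finite_Un finite_atMost finite_subset)
    qed
    moreover have "E \<subseteq> A j"
      using d(2) E(2,3) by fastforce
    then have "set (F' ! l) \<subseteq> A l" if "l \<in> set J" for l
      using F(2)[OF that] F'_j F'_other by (cases "l = j") auto
    ultimately have "cond ?p"
      using F(1) X reservoir_above[OF X(1)] by (auto simp: F'_def)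
    moreover have "between l (F, X) (set (F' ! l))" if "l \<in> set J" for l
      using F'_j F'_other E(2) by (cases "l = j") auto
    then have "extends ?p (F, X)"
      by auto
    ultimately show ?thesis
      using dec by blast
  qed
qed

text \<open>Unions of stems along a sequence of conditions: stage \<open>s\<close> puts a number at
  least \<open>s\<close> into each stem and then settles the \<open>s\<close>-th triple
  \<open>(i, c, N)\<close>.\<close>

lemma generic_sets:
  "\<exists>S. (\<forall>j\<in>set J. infinite (S j) \<and> S j \<subseteq> A j) \<and>
    (\<forall>i<k. \<forall>c N. \<exists>j\<in>set J. (\<exists>x\<ge>N. B x = i \<and> P (c ! j) (S j) x) \<or> finite {x. P (c ! j) (S j) x})"
proof -
  define req :: "nat \<Rightarrow> nat \<times> 'c list \<times> nat" where "req = from_nat"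
  define step where "step s p q \<longleftrightarrow> extends q p \<and> (\<forall>j\<in>set J. \<exists>a\<in>set (fst q ! j). s \<le> a) \<and>
      (case req s of (i, c, N) \<Rightarrow> i < k \<longrightarrow> decides i c N q)" for s p q
  have step_ex: "\<exists>q. cond q \<and> step s p q" if "cond p" for p s
  proof -
    obtain F X where p: "p = (F, X)"
      by (cases p)
    obtain i c N where req: "req s = (i, c, N)"
      by (cases "req s")
    obtain F' where F': "cond (F', X)" "extends (F', X) (F, X)" "\<forall>j\<in>set J. \<exists>a\<in>set (F' ! j). s \<le> a"
      using extension_grow \<open>cond p\<close> p by blast
    have "\<exists>q. cond q \<and> extends q (F', X) \<and> (i < k \<longrightarrow> decides i c N q)"
      using extension_decide[OF F'(1), of i c N] F'(1) by (cases "i < k") (auto intro!: exI[of _ F'])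
    then obtain q where q: "cond q" "extends q (F', X)" "i < k \<longrightarrow> decides i c N q"
      by blast
    have "\<forall>j\<in>set J. set (F' ! j) \<subseteq> set (fst q ! j)"
      using q(2) by (cases q) auto
    then have "step s p q"
      unfolding step_def using F'(3) q(3) req extends_trans[OF q(2) F'(2)] p by fastforce
    then show ?thesis
      using q(1) by blast
  qed
  have "cond (replicate m [], X0)"
    using X0 J_bound by (auto simp: subset_iff)
  then have "\<exists>f. \<forall>s. cond (f s) \<and> step s (f s) (f (Suc s))"
    using dependent_nat_choice[of "\<lambda>_. cond" step] step_ex by blast
  then obtain f where f: "\<And>s. cond (f s)" "\<And>s. step s (f s) (f (Suc s))"
    by blast
  have ext: "extends (f (s + t)) (f s)" for s t
  proof (induction t)
    case 0
    show ?case
      by (cases "f s") auto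
  next
    case (Suc t)
    then show ?case
      using extends_trans[of "f (Suc (s + t))"] f(2)[of "s + t"] unfolding step_def add_Suc_right by blast
  qed
  define S where "S j = (\<Union>s. set (fst (f s) ! j))" for j
  \<comment> \<open>Decisions quantify over all admissible sets, so they pass to the limit once it
    is admissible at every stage.\<close>
  have betw: "between j (f s) (S j)" if j: "j \<in> set J" for j s
  proof -
    have "set (fst (f t) ! j) \<subseteq> set (fst (f s) ! j) \<union> snd (f s)" for t
    proof (cases "s \<le> t")
      case True
      then show ?thesis
        using ext[of s "t - s"] j by (cases "f s"; cases "f t") auto
    next
      case False
      then show ?thesis
        using ext[of t "s - t"] j by (cases "f s"; cases "f t") auto
    qed
    then have "set (fst (f s) ! j) \<subseteq> S j" "S j \<subseteq> set (fst (f s) ! j) \<union> snd (f s)"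
      unfolding S_def by (blast, intro UN_least)
    then show ?thesis
      by (cases "f s") simp
  qed
  have "infinite (S j)" if j: "j \<in> set J" for j
    unfolding infinite_nat_iff_unbounded_le
  proof
    fix s
    obtain a where "a \<in> set (fst (f (Suc s)) ! j)" "s \<le> a"
      using f(2)[of s] j unfolding step_def by blast
    then show "\<exists>a\<ge>s. a \<in> S j"
      by (auto simp: S_def)
  qed
  moreover have "S j \<subseteq> A j" if "j \<in> set J" for j
  proof -
    have "set (fst (f s) ! j) \<subseteq> A j" for s
      using f(1)[of s] that by (cases "f s") auto
    then show ?thesis
      by (auto simp: S_def)
  qed
  moreover have "\<exists>j\<in>set J. (\<exists>x\<ge>N. B x = i \<and> P (c ! j) (S j) x) \<or> finite {x. P (c ! j) (S j) x}"
    if "i < k" for i c N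
  proof -
    define s where "s = to_nat (i, c, N)"
    have "decides i c N (f (Suc s))"
      using f(2)[of s] that unfolding step_def by (simp add: req_def s_def)
    then obtain j where j: "j \<in> set J" and
      "(\<exists>x\<ge>N. B x = i \<and> (\<forall>S. between j (f (Suc s)) S \<longrightarrow> P (c ! j) S x)) \<or>
       (\<exists>n. \<forall>S x. between j (f (Suc s)) S \<longrightarrow> P (c ! j) S x \<longrightarrow> x \<le> n)"
      unfolding decides_def by blast
    then have "(\<exists>x\<ge>N. B x = i \<and> P (c ! j) (S j) x) \<or> (\<exists>n. \<forall>x. P (c ! j) (S j) x \<longrightarrow> x \<le> n)"
      using betw[OF j, of "Suc s"] by blast
    then have "(\<exists>x\<ge>N. B x = i \<and> P (c ! j) (S j) x) \<or> finite {x. P (c ! j) (S j) x}"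
      by (auto simp: finite_nat_set_iff_bounded_le)
    then show ?thesis
      using j by blast
  qed
  ultimately show ?thesis
    by (intro exI[of _ S]) simp
qed

end

section \<open>The colouring theorem, by counting colours\<close>

context finite_use
begin

text \<open>\<open>B\<close> is fixed before the partition. If all generic sets failed, they would
  have at most \<open>m < k\<close> eventual colours, and the requirement for a missing colour gives
  a contradiction.\<close>

theorem colouring_avoids_monochromatic:
  assumes "m < k"
  shows "\<exists>B. (\<forall>x. B x < k) \<and> (\<forall>A. is_partition m A \<longrightarrow>
    (\<exists>j<m. \<exists>S. infinite S \<and> S \<subseteq> A j \<and>
      \<not> (\<exists>c i N. infinite {x. P c S x} \<and> (\<forall>x\<ge>N. P c S x \<longrightarrow> B x = i))))"
proof -
  obtain B where B: "\<forall>x. B x < k" "diagonal k B"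
    using diagonal_exists[of k] assms by auto
  have "\<exists>j<m. \<exists>S. infinite S \<and> S \<subseteq> A j \<and>
      \<not> (\<exists>c i N. infinite {x. P c S x} \<and> (\<forall>x\<ge>N. P c S x \<longrightarrow> B x = i))"
    if part: "is_partition m A" for A
  proof -
    \<comment> \<open>Minimising the number of parts that meet the reservoir in an infinite set makes these parts
      stay infinite in all later reservoirs.\<close>
    define I where "I X = {j. j < m \<and> infinite (A j \<inter> X)}" for X
    have finI: "finite (I X)" for X
      by (simp add: I_def)
    obtain X1 where X1: "X1 \<in> reservoirs" "infinite X1"
      and least: "\<And>X. X \<in> reservoirs \<Longrightarrow> infinite X \<Longrightarrow> card (I X1) \<le> card (I X)"
      using ex_has_least_nat[of "\<lambda>X. X \<in> reservoirs \<and> infinite X" UNIV "\<lambda>X. card (I X)"] UNIV_reservoir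
      by auto
    obtain J where J: "set J = I X1"
      using finite_list[OF finI] by blast
    \<comment> \<open>Parts outside \<open>I X1\<close> meet \<open>X1\<close> in finite sets; above
      a common bound \<open>u\<close> for these, only parts indexed by \<open>J\<close>
      occur.\<close>
    have "finite (\<Union>j\<in>{..<m} - I X1. A j \<inter> X1)"
      by (intro finite_UN_I) (auto simp: I_def)
    then obtain u where u: "\<forall>a\<in>(\<Union>j\<in>{..<m} - I X1. A j \<inter> X1). a \<le> u"
      unfolding finite_nat_set_iff_bounded_le by blast
    define X0 where "X0 = {a \<in> X1. u < a}"
    have inf0: "infinite X0"
    proof -
      have "X1 \<subseteq> X0 \<union> {..u}"
        by (auto simp: X0_def)
      then show ?thesis
        using X1(2) by (meson finite_Un finite_atMost finite_subset)
    qed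
    have sub0: "X0 \<subseteq> (\<Union>j\<in>set J. A j)"
    proof
      fix a
      assume a: "a \<in> X0"
      obtain j where j: "j < m" "a \<in> A j"
        using part unfolding is_partition_def by blast
      then have "j \<in> I X1"
        using u a by (force simp: X0_def)
      then show "a \<in> (\<Union>j\<in>set J. A j)"
        using J j by blast
    qed
    interpret mathias P k m B A J X0
    proof
      show "diagonal k B"
        by (rule B(2))
      show "set J \<subseteq> {..<m}"
        using J by (auto simp: I_def)
      show "X0 \<in> reservoirs"
        unfolding X0_def using X1(1) by (rule reservoir_above)
      show "infinite X0" "X0 \<subseteq> (\<Union>j\<in>set J. A j)"
        by fact+
      then show "set J \<noteq> {}"
        by auto
      fix X j
      assume X: "X \<in> reservoirs" "infinite X" "X \<subseteq> X0" and j: "j \<in> set J"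
      \<comment> \<open>A smaller reservoir meets no further part in an infinite set, and by
        minimality it loses none.\<close>
      have "I X \<subseteq> I X1"
        using X(3) by (auto simp: I_def X0_def intro: finite_subset[rotated])
      then have "I X = I X1"
        using least[OF X(1,2)] finI by (simp add: card_seteq)
      then show "infinite (A j \<inter> X)"
        using j J by (auto simp: I_def)
    qed
    obtain S where S: "\<forall>j\<in>set J. infinite (S j) \<and> S j \<subseteq> A j"
      and meets: "\<forall>i<k. \<forall>c N. \<exists>j\<in>set J. (\<exists>x\<ge>N. B x = i \<and> P (c ! j) (S j) x) \<or> finite {x. P (c ! j) (S j) x}"
      using generic_sets by (elim exE conjE)
    have "\<exists>j\<in>set J. \<not> (\<exists>c i N. infinite {x. P c (S j) x} \<and> (\<forall>x\<ge>N. P c (S j) x \<longrightarrow> B x = i))"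
    proof (rule ccontr)
      assume "\<not> ?thesis"
      then obtain c i N where bad: "\<And>j. j \<in> set J \<Longrightarrow> infinite {x. P (c j) (S j) x}"
        "\<And>j x. j \<in> set J \<Longrightarrow> x \<ge> N j \<Longrightarrow> P (c j) (S j) x \<Longrightarrow> B x = i j"
        by metis
      have "card (i ` set J) \<le> card (set J)"
        by (rule card_image_le) simp
      also have "\<dots> \<le> m"
        using card_mono[OF _ J_bound] by simp
      finally have "card (i ` set J) < card {..<k}"
        using assms by simp
      then obtain i0 where i0: "i0 < k" "i0 \<notin> i ` set J"
        by (metis List.finite_set card_mono finite_imageI lessThan_iff linorder_not_le subsetI)
      define c' where "c' = map c [0..<m]"
      have c': "c' ! j = c j" if "j \<in> set J" for j
        using that J_bound by (auto simp: c'_def)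
      \<comment> \<open>The sum is a common threshold: past it, a number enumerated by
        \<open>c j\<close> must have the colour \<open>i j\<close>, which is never
        \<open>i0\<close>.\<close>
      obtain j where j: "j \<in> set J"
        "(\<exists>x\<ge>(\<Sum>j\<in>set J. N j). B x = i0 \<and> P (c' ! j) (S j) x) \<or> finite {x. P (c' ! j) (S j) x}"
        using meets[rule_format, OF i0(1)] by blast
      then obtain x where x: "(\<Sum>j\<in>set J. N j) \<le> x" "B x = i0" "P (c j) (S j) x"
        using bad(1) c' by auto
      have "N j \<le> (\<Sum>j\<in>set J. N j)"
        using j(1) by (intro member_le_sum) auto
      then have "B x = i j"
        using bad(2)[OF j(1)] x by simp
      then show False
        using i0(2) x(2) j(1) by blast
    qed
    then show ?thesis
      using S J_bound by blast
  qed
  then show ?thesis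
    using B(1) by blast
qed

end

section \<open>Cohesive sets\<close>

lemma eq_if_bits_eq:
  fixes a b :: nat
  assumes "a < 2 ^ n" "b < 2 ^ n" "\<And>i. i < n \<Longrightarrow> bit a i = bit b i"
  shows "a = b"
proof -
  have "take_bit n a = take_bit n b"
    using assms(3) by (auto simp: bit_eq_iff bit_take_bit_iff)
  then show ?thesis
    using assms(1,2) by (simp add: take_bit_nat_eq_self)
qed

text \<open>Cohesiveness makes each of the first \<open>n\<close> bits of \<open>B\<close>
  eventually constant on \<open>C\<close>, and these determine a number below
  \<open>2 ^ n\<close>.\<close>

lemma cohesive_bits_monochromatic:
  fixes B :: "nat \<Rightarrow> nat"
  assumes B: "\<forall>x. B x < 2 ^ n" and C: "cohesive {..<n} (\<lambda>i. {x. bit (B x) i}) C"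
  shows "\<exists>i N. \<forall>x\<ge>N. x \<in> C \<longrightarrow> B x = i"
proof -
  have "\<exists>b N. \<forall>x\<ge>N. x \<in> C \<longrightarrow> bit (B x) i = b" if i: "i < n" for i
  proof -
    have "finite {x \<in> C. bit (B x) i} \<or> finite {x \<in> C. \<not> bit (B x) i}"
      using C i by (auto simp: cohesive_def Int_def)
    then have "finite {x \<in> C. bit (B x) i \<noteq> False} \<or> finite {x \<in> C. bit (B x) i \<noteq> True}"
      by simp
    then obtain b where "finite {x \<in> C. bit (B x) i \<noteq> b}"
      by (elim disjE)
    then obtain N where "\<And>x. x \<in> C \<Longrightarrow> bit (B x) i \<noteq> b \<Longrightarrow> x < N"
      unfolding finite_nat_set_iff_bounded by blast
    then show ?thesis
      by (intro exI[of _ b] exI[of _ N]) (meson not_le)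
  qed
  then obtain b N where bN: "\<And>i x. i < n \<Longrightarrow> N i \<le> x \<Longrightarrow> x \<in> C \<Longrightarrow> bit (B x) i = b i"
    by metis
  define M where "M = (\<Sum>i<n. N i)"
  have N_le: "N i \<le> M" if "i < n" for i
    unfolding M_def using that by (intro member_le_sum) auto
  have "infinite C"
    using C by (simp add: cohesive_def)
  then obtain y where y: "y \<ge> M" "y \<in> C"
    unfolding infinite_nat_iff_unbounded_le by blast
  have "B x = B y" if "x \<ge> M" "x \<in> C" for x
  proof (rule eq_if_bits_eq[of _ n])
    show "bit (B x) i = bit (B y) i" if "i < n" for i
      using bN[OF that] N_le[OF that] y \<open>x \<ge> M\<close> \<open>x \<in> C\<close> le_trans by metis
  qed (use B in auto)
  then show ?thesis
    by blast
qed

theorem theorem1p4: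
  fixes n m :: nat
  assumes "n \<ge> 2" and "m < 2 ^ n"
  shows "\<exists>R :: nat \<Rightarrow> nat set. \<forall>A :: nat \<Rightarrow> nat set.
    is_partition m A \<and> (\<forall>j<m. arithmetical_in (seq_code {..<n} R) (A j)) \<longrightarrow>
    (\<exists>j<m. \<exists>S. infinite S \<and> S \<subseteq> A j \<and>
      \<not> (\<exists>C. cohesive {..<n} R C \<and> computes S C))"
proof -
  \<comment> \<open>A code enumerates the arguments on which its output is 1.\<close>
  interpret finite_use "\<lambda>c S x. oeval S c [x] 1"
    by unfold_locales (rule oeval_use)
  obtain B :: "nat \<Rightarrow> nat" where B: "\<forall>x. B x < 2 ^ n"
    and avoid: "\<And>A. is_partition m A \<Longrightarrow> \<exists>j<m. \<exists>S. infinite S \<and> S \<subseteq> A j \<and>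
      \<not> (\<exists>c i N. infinite {x. oeval S c [x] 1} \<and> (\<forall>x\<ge>N. oeval S c [x] 1 \<longrightarrow> B x = i))"
    using colouring_avoids_monochromatic[OF assms(2)] by blast
  \<comment> \<open>Binary digits of the colour: the first \<open>n\<close> of these sets together
    determine it.\<close>
  define R where "R i = {x. bit (B x) i}" for i
  have "\<exists>c i N. infinite {x. oeval S c [x] 1} \<and> (\<forall>x\<ge>N. oeval S c [x] 1 \<longrightarrow> B x = i)"
    if C: "cohesive {..<n} R C" and "computes S C" for S C
  proof -
    obtain c where c: "\<And>x. oeval S c [x] (of_bool (x \<in> C))"
      using \<open>computes S C\<close> unfolding computes_def by blast
    \<comment> \<open>Determinism excludes output 1 outside \<open>C\<close>, where the output is
      0.\<close>
    have C_eq: "oeval S c [x] 1 \<longleftrightarrow> x \<in> C" for x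
      using c[of x] oeval_deterministic[OF c[of x], of 1] by (auto simp: of_bool_def split: if_splits)
    obtain i N where "\<forall>x\<ge>N. x \<in> C \<longrightarrow> B x = i"
      using cohesive_bits_monochromatic[OF B] C unfolding R_def by blast
    moreover have "infinite C"
      using C by (simp add: cohesive_def)
    ultimately show ?thesis
      using C_eq by (intro exI[of _ c] exI[of _ i] exI[of _ N]) simp
  qed
  then show ?thesis
    using avoid by (intro exI[of _ R]) meson
qed

end
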